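(* $\psi_3(8)=\frac{13}{5}$.
   Context: A right tiling of the unit square $[0,1]^2$ with $n$ squares is a collection of $n$ squares (of positive side length) contained in the unit square, with sides parallel to the sides of the unit square, with pairwise disjoint interiors, and whose union is the whole unit square. If the squares have side lengths $s_1,\dots,s_n$, then, for $n\neq 2,3,5$, $\psi_3(n)$ is defined as $\max\sum_{i=1}^n s_i$, the maximum being over all right tilings of the unit square with exactly $n$ squares. *)

theory Defs
  imports "HOL-Analysis.Analysis"
begin

text \<open>The closed axis-parallel square with lower left corner \<open>p\<close> and side length \<open>s\<close>.\<close>

definition axis_square :: "real \<times> real \<Rightarrow> real \<Rightarrow> (real \<times> real) set" where
  "axis_square p s = cbox p (p + (s, s))"

text \<open>A tiling is a finite set of pairs (lower left corner, side length). Since side lengths are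
  positive, distinct pairs denote distinct squares, so the cardinality is the number of squares.\<close>

definition right_tiling :: "((real \<times> real) \<times> real) set \<Rightarrow> bool" where
  "right_tiling T \<longleftrightarrow>
     finite T \<and>
     (\<forall>(p, s) \<in> T. 0 < s \<and> axis_square p s \<subseteq> axis_square (0, 0) 1) \<and>
     pairwise (\<lambda>(p, s) (q, t). interior (axis_square p s) \<inter> interior (axis_square q t) = {}) T \<and>
     (\<Union>(p, s) \<in> T. axis_square p s) = axis_square (0, 0) 1"

text \<open>\<open>GREATEST\<close> is an attained maximum; the value is unspecified when no maximum exists, in
  particular for \<open>n = 2, 3, 5\<close>, where there is no tiling.\<close>

definition psi3 :: "nat \<Rightarrow> real" where
  "psi3 n = (GREATEST m. \<exists>T. right_tiling T \<and> card T = n \<and> m = (\<Sum>(p, s) \<in> T. s))"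

end

theory Submission
  imports Defs
begin

text \<open>
  The squares touching the top side have total side length \<open>1\<close>, so it remains to bound the other
  squares. If the lower left corner square has side \<open>1 - t \<ge> 1/2\<close>, all others have side at most
  \<open>t\<close>, and after a diagonal reflection at most three of the other seven start below height
  \<open>1 - t\<close>. If no corner square has side at least \<open>1/2\<close>, each side of the unit square touches
  a square that avoids the corners, and counting leaves exactly three squares at the bottom and three
  at the top. In both cases the unit square is filled from below: some square always sits in the left
  corner of a local minimum of the current skyline, and comparing its side with the width and depth of
  that valley gives a small finite tree of linear systems, all of which contradict
  \<open>\<Sum> s > 13/5\<close>.
\<close>

section \<open>Partial tilings of the region above a skyline\<close>

abbreviation lx :: "(real \<times> real) \<times> real \<Rightarrow> real" where "lx q \<equiv> fst (fst q)"
abbreviation ly :: "(real \<times> real) \<times> real \<Rightarrow> real" where "ly q \<equiv> snd (fst q)"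
abbreviation sd :: "(real \<times> real) \<times> real \<Rightarrow> real" where "sd q \<equiv> snd q"

text \<open>Half-open squares that meet only along edges are disjoint as sets, so a tiling becomes
  an exact partition and placing a square becomes a set difference.\<close>

definition half_open :: "(real \<times> real) \<times> real \<Rightarrow> (real \<times> real) set" where
  "half_open q = {lx q..<lx q + sd q} \<times> {ly q..<ly q + sd q}"

definition tiles :: "((real \<times> real) \<times> real) set \<Rightarrow> (real \<times> real) set \<Rightarrow> bool" where
  "tiles Q R \<longleftrightarrow> finite Q \<and> (\<forall>q\<in>Q. 0 < sd q) \<and>
     (\<forall>q\<in>Q. \<forall>r\<in>Q. q \<noteq> r \<longrightarrow> half_open q \<inter> half_open r = {}) \<and> (\<Union>q\<in>Q. half_open q) = R"

text \<open>
  A skyline is kept as a zipper: a focused segment of width \<open>w\<close> at height \<open>h\<close> starting at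
  abscissa \<open>x\<close>, the segments \<open>ls\<close> to its left (nearest first) and the segments \<open>rs\<close> to its
  right. The region still to be filled lies above the skyline and below height \<open>1\<close>.
\<close>

fun right_region :: "real \<Rightarrow> (real \<times> real) list \<Rightarrow> (real \<times> real) set" where
  "right_region x [] = {}"
| "right_region x ((w, h) # S) = {x..<x + w} \<times> {h..<1} \<union> right_region (x + w) S"

fun left_region :: "real \<Rightarrow> (real \<times> real) list \<Rightarrow> (real \<times> real) set" where
  "left_region x [] = {}"
| "left_region x ((w, h) # S) = {x - w..<x} \<times> {h..<1} \<union> left_region (x - w) S"

text \<open>The empty list stands for a vertical side of the unit square, a wall that bounds the
  focus at every height; hence the value \<open>True\<close>.\<close>

fun higher :: "real \<Rightarrow> (real \<times> real) list \<Rightarrow> bool" where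
  "higher h [] = True"
| "higher h ((w, h') # S) = (h < h')"

definition valid :: "(real \<times> real) list \<Rightarrow> bool" where
  "valid S \<longleftrightarrow> (\<forall>(w, h)\<in>set S. 0 < w \<and> h \<le> 1)"

lemma valid_simps [simp]: "valid []" "valid ((w, h) # S) \<longleftrightarrow> 0 < w \<and> h \<le> 1 \<and> valid S"
  by (auto simp: valid_def)

lemma right_region_ge: "valid S \<Longrightarrow> p \<in> right_region x S \<Longrightarrow> x \<le> fst p"
  by (induction S arbitrary: x) fastforce+

lemma left_region_less: "valid S \<Longrightarrow> p \<in> left_region x S \<Longrightarrow> fst p < x"
  by (induction S arbitrary: x) fastforce+

lemma right_region_higher: "valid S \<Longrightarrow> higher h S \<Longrightarrow> (x, h) \<notin> right_region x S"
  by (cases S) (fastforce dest: right_region_ge)+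

text \<open>Half-open intervals omit their right end, so no single boundary point serves here as it
  does in \<open>right_region_higher\<close>; what is found instead is a gap arbitrarily close to
  \<open>x\<close> from the left.\<close>

lemma left_region_higher:
  assumes "valid S" "higher h S" "z < x"
  shows "\<exists>y. z \<le> y \<and> y < x \<and> (y, h) \<notin> left_region x S"
proof (cases S)
  case Nil
  with assms show ?thesis by auto
next
  case (Cons s S')
  obtain w h' where s: "s = (w, h')" by fastforce
  show ?thesis
    using assms Cons s by (intro exI[of _ "max z (x - w)"]) (auto dest: left_region_less)
qed

lemma tiles_remove:
  assumes "tiles Q R" "q \<in> Q"
  shows "tiles (Q - {q}) (R - half_open q)"
proof -
  have "(\<Union>r\<in>Q - {q}. half_open r) = (\<Union>r\<in>Q. half_open r) - half_open q"
    using assms unfolding tiles_def by blast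
  then show ?thesis using assms by (auto simp: tiles_def)
qed

abbreviation region where
  "region x ls w h rs \<equiv> left_region x ls \<union> {x..<x + w} \<times> {h..<1} \<union> right_region (x + w) rs"

text \<open>The square covering the point \<open>(x, h)\<close> must have it as lower left corner:
  reaching further left or down, it would contain points outside the region. The higher right
  neighbour and the top of the unit square cap its side in the same way.\<close>

lemma place_square:
  assumes T: "tiles Q (region x ls w h rs)" and v: "valid ls" "valid rs" "0 < w" "h < 1"
    and hi: "higher h ls" "higher h rs"
  obtains s where "((x, h), s) \<in> Q" "0 < s" "s \<le> w" "s \<le> 1 - h"
    "tiles (Q - {((x, h), s)}) (left_region x ls \<union> {x..<x + s} \<times> {h + s..<1}
       \<union> {x + s..<x + w} \<times> {h..<1} \<union> right_region (x + w) rs)"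
proof -
  let ?R = "region x ls w h rs"
  have "(x, h) \<in> ?R" using v by auto
  then obtain q where q: "q \<in> Q" "(x, h) \<in> half_open q" using T unfolding tiles_def by blast
  have sub: "half_open q \<subseteq> ?R" using T q unfolding tiles_def by blast
  obtain a b s where abs: "q = ((a, b), s)" by (metis surj_pair)
  have in_q: "(y, z) \<in> half_open q \<longleftrightarrow> a \<le> y \<and> y < a + s \<and> b \<le> z \<and> z < b + s" for y z
    by (auto simp: half_open_def abs)
  have a: "a = x"
  proof (rule ccontr)
    assume "a \<noteq> x"
    then have "a < x" using q in_q by simp
    then obtain y where y: "a \<le> y" "y < x" "(y, h) \<notin> left_region x ls"
      using left_region_higher[OF v(1) hi(1)] by blast
    then have "(y, h) \<in> ?R" using sub q in_q[of x h] in_q[of y h] by fastforce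
    then show False using y right_region_ge[OF v(2), of "(y, h)" "x + w"] v by auto
  qed
  have b: "b = h"
  proof (rule ccontr)
    assume "b \<noteq> h"
    then have "b < h" using q in_q by simp
    then have "(x, b) \<in> ?R" using sub q in_q[of x h] in_q[of x b] by fastforce
    then show False using \<open>b < h\<close> left_region_less[OF v(1), of "(x, b)" x]
        right_region_ge[OF v(2), of "(x, b)" "x + w"] v by auto
  qed
  have s0: "0 < s" using T q abs unfolding tiles_def by auto
  have sw: "s \<le> w"
  proof (rule ccontr)
    assume "\<not> s \<le> w"
    then have "(x + w, h) \<in> ?R" using sub in_q[of "x + w" h] v a b by auto
    then show False
      using right_region_higher[OF v(2) hi(2)] left_region_less[OF v(1), of "(x + w, h)" x] v by auto
  qed
  have s1: "s \<le> 1 - h"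
  proof (rule ccontr)
    assume "\<not> s \<le> 1 - h"
    then have "(x, 1) \<in> ?R" using sub in_q[of x 1] v a b s0 by auto
    then show False using left_region_less[OF v(1), of "(x, 1)" x]
        right_region_ge[OF v(2), of "(x, 1)" "x + w"] v by auto
  qed
  have "?R - half_open q = left_region x ls \<union> {x..<x + s} \<times> {h + s..<1}
       \<union> {x + s..<x + w} \<times> {h..<1} \<union> right_region (x + w) rs"
    using s0 sw s1 v(3,4) left_region_less[OF v(1), of _ x] right_region_ge[OF v(2), of _ "x + w"]
    by (fastforce simp: half_open_def abs a b)
  then show thesis using that[of s] tiles_remove[OF T q(1)] q(1) s0 sw s1 by (simp add: abs a b)
qed

section \<open>Bookkeeping of numbers of squares and sums of sides\<close>

definition touches_top :: "(real \<times> real) \<times> real \<Rightarrow> bool" where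
  "touches_top q \<longleftrightarrow> ly q + sd q = 1"

text \<open>
  \<open>n\<close> bounds the number of squares whose bottom height satisfies \<open>P\<close>, and \<open>t\<close> bounds
  all sides. The numbers of squares touching and not touching the top are recorded as their multiples
  \<open>K\<close> and \<open>M\<close> by \<open>t\<close>, so that the bounds \<open>v \<le> K\<close> and \<open>u \<le> M\<close> on the respective
  side sums are linear.
\<close>

definition counts where
  "counts P t n K M v u Q \<longleftrightarrow>
     real (card {q\<in>Q. P (ly q)}) \<le> n \<and> (\<forall>q\<in>Q. sd q \<le> t) \<and>
     K = t * real (card {q\<in>Q. touches_top q}) \<and> M = t * real (card {q\<in>Q. \<not> touches_top q}) \<and>
     v = (\<Sum>q | q \<in> Q \<and> touches_top q. sd q) \<and> u = (\<Sum>q | q \<in> Q \<and> \<not> touches_top q. sd q)"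

lemma counts_bound:
  assumes "counts P t n K M v u Q" "finite Q" "\<forall>q\<in>Q. 0 < sd q"
  shows "0 \<le> v" "v \<le> K" "0 \<le> u" "u \<le> M"
proof -
  have "(\<Sum>q | q \<in> Q \<and> touches_top q. sd q) \<le> real (card {q \<in> Q. touches_top q}) * t"
    using assms by (intro sum_bounded_above) (auto simp: counts_def)
  moreover have "(\<Sum>q | q \<in> Q \<and> \<not> touches_top q. sd q) \<le> real (card {q \<in> Q. \<not> touches_top q}) * t"
    using assms by (intro sum_bounded_above) (auto simp: counts_def)
  ultimately show "v \<le> K" "u \<le> M" using assms by (auto simp: counts_def mult.commute)
  show "0 \<le> v" "0 \<le> u" using assms by (auto simp: counts_def intro!: sum_nonneg intro: less_imp_le)
qed

text \<open>The inequality for \<open>n'\<close> treats squares with and without \<open>P\<close>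
  alike, and it suits \<open>fill3\<close>, where the bound is lowered before the square is
  removed.\<close>

lemma counts_remove:
  assumes c: "counts P t n K M v u Q" and f: "finite Q" and q: "q \<in> Q"
    and n: "n - of_bool (P (ly q)) \<le> n'"
  shows "counts P t n' (K - of_bool (touches_top q) * t) (M - of_bool (\<not> touches_top q) * t)
     (v - of_bool (touches_top q) * sd q) (u - of_bool (\<not> touches_top q) * sd q) (Q - {q})"
proof -
  have e: "{r \<in> Q - {q}. A r} = {r \<in> Q. A r} - {q}" for A by auto
  have cd: "real (card {r \<in> Q - {q}. A r}) = real (card {r \<in> Q. A r}) - of_bool (A q)" for A
  proof (cases "A q")
    case True
    then have "{r \<in> Q. A r} \<noteq> {}" using q by blast
    then have "0 < card {r \<in> Q. A r}" using f by (simp add: card_gt_0_iff)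
    with True show ?thesis unfolding e using q by (simp add: card_Diff_singleton_if of_nat_diff)
  next
    case False
    then have "{r \<in> Q - {q}. A r} = {r \<in> Q. A r}" by auto
    with False show ?thesis by simp
  qed
  have sm: "(\<Sum>r | r \<in> Q - {q} \<and> A r. sd r) = (\<Sum>r | r \<in> Q \<and> A r. sd r) - of_bool (A q) * sd q"
    for A
  proof -
    have "{r. r \<in> Q - {q} \<and> A r} = {r. r \<in> Q \<and> A r} - {q}" by auto
    then show ?thesis using f q by (auto simp: sum_diff1)
  qed
  show ?thesis using c n unfolding counts_def cd sm by (auto simp: algebra_simps)
qed

definition filling where
  "filling P t n K M v u Q x ls w h rs \<longleftrightarrow> tiles Q (region x ls w h rs) \<and>
     valid ls \<and> valid rs \<and> 0 < w \<and> h \<le> 1 \<and> counts P t n K M v u Q"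

text \<open>
  The indices count what is known of the neighbours of the focus: nothing, the right one is higher,
  both are higher, and finally that the square placed in the focus has been no longer counted in
  the bound \<open>n'\<close>.
\<close>

definition fill0 where
  "fill0 P t n K M v u ls w h rs \<longleftrightarrow> (\<exists>Q x. filling P t n K M v u Q x ls w h rs)"
definition fill1 where
  "fill1 P t n K M v u ls w h rs \<longleftrightarrow> (\<exists>Q x. filling P t n K M v u Q x ls w h rs) \<and> higher h rs"
definition fill2 where
  "fill2 P t n K M v u ls w h rs \<longleftrightarrow> (\<exists>Q x. filling P t n K M v u Q x ls w h rs)
     \<and> higher h rs \<and> higher h ls"
definition fill3 where
  "fill3 P t n' K M v u ls w h rs \<longleftrightarrow>
     (\<exists>Q x n. filling P t n K M v u Q x ls w h rs \<and> n - of_bool (P h) \<le> n')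
     \<and> higher h rs \<and> higher h ls \<and> h < 1"

section \<open>Case rules for walking along the skyline and placing a square\<close>

lemma fill0_Nil: "fill0 P t n K M v u ls w h [] \<Longrightarrow> (fill1 P t n K M v u ls w h [] \<Longrightarrow> R) \<Longrightarrow> R"
  by (auto simp: fill0_def fill1_def)

text \<open>The focus moves right, merging segments of equal height, until its right neighbour is
  higher. \<open>Q\<close> and \<open>x\<close> stay hidden under the existential, so only linear
  conditions on widths and heights become visible.\<close>

lemma fill0_Cons:
  assumes "fill0 P t n K M v u ls w h ((w2, h2) # rs)"
    and "h < h2 \<Longrightarrow> fill1 P t n K M v u ls w h ((w2, h2) # rs) \<Longrightarrow> R"
    and "h = h2 \<Longrightarrow> fill0 P t n K M v u ls (w + w2) h rs \<Longrightarrow> R"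
    and "h2 < h \<Longrightarrow> fill0 P t n K M v u ((w, h) # ls) w2 h2 rs \<Longrightarrow> R"
  shows R
proof -
  obtain Q x where Q: "filling P t n K M v u Q x ls w h ((w2, h2) # rs)"
    using assms(1) by (auto simp: fill0_def)
  consider "h < h2" | "h = h2" | "h2 < h" by linarith
  then show R
  proof cases
    case 1
    with Q show R by (intro assms(2)) (auto simp: fill1_def)
  next
    case 2
    have "region x ls (w + w2) h rs = region x ls w h ((w2, h2) # rs)"
      using Q 2 by (auto simp: filling_def add.assoc)
    with Q 2 have "filling P t n K M v u Q x ls (w + w2) h rs" by (simp add: filling_def)
    with 2 show R by (intro assms(3)) (auto simp: fill0_def)
  next
    case 3
    have "region (x + w) ((w, h) # ls) w2 h2 rs = region x ls w h ((w2, h2) # rs)" by auto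
    with Q 3 have "filling P t n K M v u Q (x + w) ((w, h) # ls) w2 h2 rs" by (simp add: filling_def)
    with 3 show R by (intro assms(4)) (auto simp: fill0_def)
  qed
qed

lemma fill1_Nil: "fill1 P t n K M v u [] w h rs \<Longrightarrow> (fill2 P t n K M v u [] w h rs \<Longrightarrow> R) \<Longrightarrow> R"
  by (auto simp: fill1_def fill2_def)

text \<open>When the focus moves left, the old focus becomes a higher right neighbour, so the search
  for a valley never has to turn back to the right.\<close>

lemma fill1_Cons:
  assumes "fill1 P t n K M v u ((w1, h1) # ls) w h rs"
    and "h < h1 \<Longrightarrow> fill2 P t n K M v u ((w1, h1) # ls) w h rs \<Longrightarrow> R"
    and "h = h1 \<Longrightarrow> fill1 P t n K M v u ls (w1 + w) h rs \<Longrightarrow> R"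
    and "h1 < h \<Longrightarrow> fill1 P t n K M v u ls w1 h1 ((w, h) # rs) \<Longrightarrow> R"
  shows R
proof -
  obtain Q x where Q: "filling P t n K M v u Q x ((w1, h1) # ls) w h rs" and hi: "higher h rs"
    using assms(1) by (auto simp: fill1_def)
  consider "h < h1" | "h = h1" | "h1 < h" by linarith
  then show R
  proof cases
    case 1
    with Q hi show R by (intro assms(2)) (auto simp: fill2_def)
  next
    case 2
    have "region (x - w1) ls (w1 + w) h rs = region x ((w1, h1) # ls) w h rs"
      using Q 2 by (auto simp: filling_def)
    with Q 2 have "filling P t n K M v u Q (x - w1) ls (w1 + w) h rs" by (simp add: filling_def)
    with 2 hi show R by (intro assms(3)) (auto simp: fill1_def)
  next
    case 3
    have "region (x - w1) ls w1 h1 ((w, h) # rs) = region x ((w1, h1) # ls) w h rs" by auto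
    with Q 3 have "filling P t n K M v u Q (x - w1) ls w1 h1 ((w, h) # rs)" by (simp add: filling_def)
    with 3 show R by (intro assms(4)) (auto simp: fill1_def)
  qed
qed

lemma fill2_cases:
  assumes "fill2 P t n K M v u ls w h rs"
    and "h < 1 \<Longrightarrow> P h \<Longrightarrow> 1 \<le> n \<Longrightarrow> fill3 P t (n - 1) K M v u ls w h rs \<Longrightarrow> R"
    and "h < 1 \<Longrightarrow> \<not> P h \<Longrightarrow> fill3 P t n K M v u ls w h rs \<Longrightarrow> R"
    and "h = 1 \<Longrightarrow> K = 0 \<Longrightarrow> M = 0 \<Longrightarrow> R"
  shows R
proof -
  obtain Q x where Q: "filling P t n K M v u Q x ls w h rs" and hi: "higher h rs" "higher h ls"
    using assms(1) by (auto simp: fill2_def)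
  show R
  proof (cases "h = 1")
    case True
    \<comment> \<open>No segment is higher than 1, so both neighbours must be walls and nothing
      remains to be filled.\<close>
    have "ls = []" "rs = []" using Q hi True by (cases ls; cases rs; force simp: filling_def)+
    with Q True have "(\<Union>q\<in>Q. half_open q) = {}" "\<forall>q\<in>Q. 0 < sd q"
      by (auto simp: filling_def tiles_def)
    then have "Q = {}" by (fastforce simp: half_open_def)
    with Q True show R by (intro assms(4)) (auto simp: filling_def counts_def)
  next
    case False
    then have h: "h < 1" using Q by (auto simp: filling_def)
    have fin: "finite Q" using Q by (auto simp: filling_def tiles_def)
    show R
    proof (cases "P h")
      case True
      \<comment> \<open>The square sitting in the valley has its bottom at \<open>h\<close> and is
        therefore counted by \<open>n\<close>; an exhausted bound thus closes the branch.\<close>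
      obtain s where "((x, h), s) \<in> Q"
        using place_square[of Q x ls w h rs] Q h hi by (auto simp: filling_def)
      then have "{q \<in> Q. P (ly q)} \<noteq> {}" using True by auto
      then have "1 \<le> card {q \<in> Q. P (ly q)}" using fin by (simp add: Suc_le_eq card_gt_0_iff)
      then have "1 \<le> n" using Q by (auto simp: filling_def counts_def)
      then show R using Q h hi True by (intro assms(2)) (force simp: fill3_def)+
    next
      case False
      then show R using Q h hi by (intro assms(3)) (force simp: fill3_def)+
    qed
  qed
qed

text \<open>The four cases ask whether the new square spans the valley and whether it reaches the
  top. A spanned valley changes its height, so both neighbours are compared anew
  (\<open>fill0\<close>); otherwise the rest of the valley keeps its higher right neighbour
  (\<open>fill1\<close>). The inequalities about \<open>K\<close>, \<open>M\<close>,
  \<open>v\<close> and \<open>u\<close> are handed over to prune branches.\<close>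

lemma fill3_cases:
  assumes "fill3 P t n K M v u ls w h rs"
    and "w = 1 - h \<Longrightarrow> w \<le> t \<Longrightarrow> t \<le> K \<Longrightarrow> 0 \<le> v - w \<Longrightarrow> v - w \<le> K - t \<Longrightarrow>
        fill0 P t n (K - t) M (v - w) u ls w 1 rs \<Longrightarrow> R"
    and "1 - h < w \<Longrightarrow> 1 - h \<le> t \<Longrightarrow> t \<le> K \<Longrightarrow> 0 \<le> v - (1 - h) \<Longrightarrow> v - (1 - h) \<le> K - t \<Longrightarrow>
        fill1 P t n (K - t) M (v - (1 - h)) u ((1 - h, 1) # ls) (w - (1 - h)) h rs \<Longrightarrow> R"
    and "w < 1 - h \<Longrightarrow> w \<le> t \<Longrightarrow> t \<le> M \<Longrightarrow> 0 \<le> u - w \<Longrightarrow> u - w \<le> M - t \<Longrightarrow>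
        fill0 P t n K (M - t) v (u - w) ls w (h + w) rs \<Longrightarrow> R"
    and "\<And>s. 0 < s \<Longrightarrow> s < 1 - h \<Longrightarrow> s < w \<Longrightarrow> s \<le> t \<Longrightarrow> t \<le> M \<Longrightarrow> 0 \<le> u - s \<Longrightarrow> u - s \<le> M - t \<Longrightarrow>
        fill1 P t n K (M - t) v (u - s) ((s, h + s) # ls) (w - s) h rs \<Longrightarrow> R"
  shows R
proof -
  obtain Q x n0 where Q: "filling P t n0 K M v u Q x ls w h rs" and n0: "n0 - of_bool (P h) \<le> n"
    and hi: "higher h rs" "higher h ls" and h: "h < 1"
    using assms(1) by (auto simp: fill3_def)
  have Q': "tiles Q (region x ls w h rs)" "valid ls" "valid rs" "0 < w" "counts P t n0 K M v u Q"
    using Q by (auto simp: filling_def)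
  obtain s where s: "((x, h), s) \<in> Q" "0 < s" "s \<le> w" "s \<le> 1 - h"
    "tiles (Q - {((x, h), s)}) (left_region x ls \<union> {x..<x + s} \<times> {h + s..<1}
       \<union> {x + s..<x + w} \<times> {h..<1} \<union> right_region (x + w) rs)"
    using place_square[OF Q'(1-4) h hi(2,1)] by blast
  let ?q = "((x, h), s)" and ?Q = "Q - {((x, h), s)}"
  have fin: "finite Q" and pos: "\<forall>q\<in>?Q. 0 < sd q" and st: "s \<le> t" "0 < t"
    using Q' s(1,2) by (force simp: tiles_def counts_def)+
  have top: "touches_top ?q \<longleftrightarrow> s = 1 - h" by (auto simp: touches_top_def)
  note cnt = counts_remove[OF Q'(5) fin s(1), of n]
  have full: "filling P t n K' M' v' u' ?Q x ls w (h + w) rs"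
    if "s = w" "counts P t n K' M' v' u' ?Q" for K' M' v' u'
    using s Q' that by (simp add: filling_def)
  have part: "filling P t n K' M' v' u' ?Q (x + s) ((s, h + s) # ls) (w - s) h rs"
    if "s < w" "counts P t n K' M' v' u' ?Q" for K' M' v' u'
  proof -
    have "region (x + s) ((s, h + s) # ls) (w - s) h rs = left_region x ls
       \<union> {x..<x + s} \<times> {h + s..<1} \<union> {x + s..<x + w} \<times> {h..<1} \<union> right_region (x + w) rs" by auto
    then show ?thesis using s Q' that h by (simp add: filling_def)
  qed
  show R
  proof (cases "s = 1 - h")
    case True
    have c: "counts P t n (K - t) M (v - s) u ?Q" using cnt n0 True top by simp
    note b = counts_bound[OF c _ pos] counts_bound[OF Q'(5)]
    \<comment> \<open>\<open>K\<close> is a multiple of \<open>t\<close>, and the new square is one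
      of those it counts.\<close>
    have "t \<le> K"
    proof -
      have "0 < card {q \<in> Q. touches_top q}" using fin s(1) top True by (auto simp: card_gt_0_iff)
      then have "t * 1 \<le> t * real (card {q \<in> Q. touches_top q})"
        using st by (intro mult_left_mono) auto
      then show ?thesis using Q'(5) by (simp add: counts_def)
    qed
    then show R using full[OF _ c] part[OF _ c] s True st b fin hi h
      by (cases "s = w") (force intro: assms(2,3) simp: fill0_def fill1_def)+
  next
    case False
    have c: "counts P t n K (M - t) v (u - s) ?Q" using cnt n0 False top by simp
    note b = counts_bound[OF c _ pos] counts_bound[OF Q'(5)]
    have "t \<le> M"
    proof -
      have "0 < card {q \<in> Q. \<not> touches_top q}" using fin s(1) top False by (auto simp: card_gt_0_iff)
      then have "t * 1 \<le> t * real (card {q \<in> Q. \<not> touches_top q})"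
        using st by (intro mult_left_mono) auto
      then show ?thesis using Q'(5) by (simp add: counts_def)
    qed
    then show R using full[OF _ c] part[OF _ c] s False st b fin hi h
      by (cases "s = w") (force intro: assms(4) assms(5)[of s] simp: fill0_def fill1_def)+
  qed
qed

subsection \<open>Exhausting the fillings\<close>

text \<open>The corner square has side \<open>1 - t\<close>; four of the other seven squares touch
  the top. The total is \<open>(1 - t) + 1 + u\<close>, so the bound on \<open>u\<close> says that
  it exceeds 13/5. Each placed square lowers \<open>K\<close> or \<open>M\<close> by
  \<open>t\<close>, which ends the search, and linear arithmetic is tried before each split. Fixing
  the number of top squares, here and in the next two lemmas, keeps \<open>K\<close> and
  \<open>M\<close> linear in \<open>t\<close>.\<close>

lemma no_filling_4_3:
  assumes "fill0 (\<lambda>y. y < 1 - t) t 3 (t * 4) (t * 3) 1 u [(1 - t, 1 - t)] t 0 []"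
    and "3 / 5 + t < u" "0 < t" "t \<le> 1 / 2" "1 \<le> t * 4" "u \<le> t * 3"
  shows False
  by (insert assms, (erule fill0_Nil fill1_Nil | linarith
        | erule fill0_Cons fill1_Cons fill2_cases fill3_cases)+)

lemma no_filling_3_4:
  assumes "fill0 (\<lambda>y. y < 1 - t) t 3 (t * 3) (t * 4) 1 u [(1 - t, 1 - t)] t 0 []"
    and "3 / 5 + t < u" "0 < t" "t \<le> 1 / 2" "1 \<le> t * 3" "u \<le> t * 4"
  shows False
  by (insert assms, (erule fill0_Nil fill1_Nil | linarith
        | erule fill0_Cons fill1_Cons fill2_cases fill3_cases)+)

lemma no_filling_2_5:
  assumes "fill0 (\<lambda>y. y < 1 - t) t 3 (t * 2) (t * 5) 1 u [(1 - t, 1 - t)] t 0 []"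
    and "3 / 5 + t < u" "0 < t" "t \<le> 1 / 2" "1 \<le> t * 2" "u \<le> t * 5"
  shows False
  by (insert assms, (erule fill0_Nil fill1_Nil | linarith
        | erule fill0_Cons fill1_Cons fill2_cases fill3_cases)+)

text \<open>
  The condition is \<open>y \<le> 0\<close> and not \<open>y = 0\<close> because \<open>linarith\<close> splits on every
  negated equation.
\<close>

lemma no_filling_small_corner:
  assumes "fill0 (\<lambda>y. y \<le> 0) 1 2 3 4 1 u [(s, s)] (1 - s) 0 []"
    and "0 < s" "s < 1 / 2" "8 / 5 - s < u"
  shows False
  by (insert assms, (erule fill0_Nil fill1_Nil | linarith
        | erule fill0_Cons fill1_Cons fill2_cases fill3_cases)+)

subsection \<open>Tilings of the unit square\<close>

text \<open>This is \<open>right_tiling\<close> in coordinates, with every condition reduced to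
  linear inequalities.\<close>

definition tiling :: "((real \<times> real) \<times> real) set \<Rightarrow> bool" where
  "tiling T \<longleftrightarrow> finite T \<and>
     (\<forall>q\<in>T. 0 < sd q \<and> 0 \<le> lx q \<and> 0 \<le> ly q \<and> lx q + sd q \<le> 1 \<and> ly q + sd q \<le> 1) \<and>
     (\<forall>q\<in>T. \<forall>r\<in>T. q \<noteq> r \<longrightarrow> lx q + sd q \<le> lx r \<or> lx r + sd r \<le> lx q \<or>
        ly q + sd q \<le> ly r \<or> ly r + sd r \<le> ly q) \<and>
     (\<forall>x\<in>{0..1}. \<forall>y\<in>{0..1}. \<exists>q\<in>T. lx q \<le> x \<and> x \<le> lx q + sd q \<and> ly q \<le> y \<and> y \<le> ly q + sd q)"

lemma mem_axis_square:
  "p \<in> axis_square c s \<longleftrightarrow>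
    fst c \<le> fst p \<and> fst p \<le> fst c + s \<and> snd c \<le> snd p \<and> snd p \<le> snd c + s"
  by (cases p; cases c) (auto simp: axis_square_def)

lemma unit_square: "axis_square (0, 0) 1 = {0..1} \<times> {0..1}"
  by (auto simp: mem_axis_square)

lemma interior_axis_square_disjoint:
  assumes "0 < s" "0 < t"
  shows "interior (axis_square (x, y) s) \<inter> interior (axis_square (x', y') t) = {} \<longleftrightarrow>
    x + s \<le> x' \<or> x' + t \<le> x \<or> y + s \<le> y' \<or> y' + t \<le> y"
proof -
  have "interior (axis_square (x, y) s) \<inter> interior (axis_square (x', y') t) =
     {max x x'<..<min (x + s) (x' + t)} \<times> {max y y'<..<min (y + s) (y' + t)}"
    by (auto simp: axis_square_def box_prod box_real)
  then show ?thesis using assms by (auto simp: min_def max_def)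
qed

lemma right_tiling_iff: "right_tiling T \<longleftrightarrow> tiling T"
proof -
  have sub: "axis_square p s \<subseteq> axis_square (0, 0) 1 \<longleftrightarrow>
      0 \<le> fst p \<and> 0 \<le> snd p \<and> fst p + s \<le> 1 \<and> snd p + s \<le> 1" if "0 < s" for p s
  proof
    assume "axis_square p s \<subseteq> axis_square (0, 0) 1"
    \<comment> \<open>Two opposite corners decide containment.\<close>
    moreover have "p \<in> axis_square p s" "p + (s, s) \<in> axis_square p s"
      using that by (cases p; simp add: mem_axis_square)+
    ultimately have "p \<in> axis_square (0, 0) 1" "p + (s, s) \<in> axis_square (0, 0) 1" by blast+
    then show "0 \<le> fst p \<and> 0 \<le> snd p \<and> fst p + s \<le> 1 \<and> snd p + s \<le> 1"
      by (cases p) (simp add: mem_axis_square)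
  qed (cases p, auto simp: mem_axis_square)
  have inside: "(\<forall>(p, s)\<in>T. 0 < s \<and> axis_square p s \<subseteq> axis_square (0, 0) 1) \<longleftrightarrow>
    (\<forall>q\<in>T. 0 < sd q \<and> 0 \<le> lx q \<and> 0 \<le> ly q \<and> lx q + sd q \<le> 1 \<and> ly q + sd q \<le> 1)"
    unfolding split_def by (intro ball_cong refl conj_cong sub)
  have disj: "pairwise (\<lambda>(p, s) (q, t). interior (axis_square p s) \<inter> interior (axis_square q t) = {}) T \<longleftrightarrow>
     (\<forall>q\<in>T. \<forall>r\<in>T. q \<noteq> r \<longrightarrow> lx q + sd q \<le> lx r \<or> lx r + sd r \<le> lx q \<or>
        ly q + sd q \<le> ly r \<or> ly r + sd r \<le> ly q)" if "\<forall>q\<in>T. 0 < sd q"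
  proof -
    have "interior (axis_square (fst q) (sd q)) \<inter> interior (axis_square (fst r) (sd r)) = {} \<longleftrightarrow>
      lx q + sd q \<le> lx r \<or> lx r + sd r \<le> lx q \<or> ly q + sd q \<le> ly r \<or> ly r + sd r \<le> ly q"
      if "q \<in> T" "r \<in> T" for q r
      using interior_axis_square_disjoint[of "sd q" "sd r" "lx q" "ly q" "lx r" "ly r"]
        \<open>\<forall>q\<in>T. 0 < sd q\<close> that by simp
    then show ?thesis
      unfolding pairwise_def split_def by (intro ball_cong refl arg_cong2[where f = "(\<longrightarrow>)"])
  qed
  have cover: "(\<Union>(p, s)\<in>T. axis_square p s) = axis_square (0, 0) 1 \<longleftrightarrow>
    (\<forall>x\<in>{0..1}. \<forall>y\<in>{0..1}. \<exists>q\<in>T. lx q \<le> x \<and> x \<le> lx q + sd q \<and> ly q \<le> y \<and> y \<le> ly q + sd q)"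
    if "\<forall>(p, s)\<in>T. 0 < s \<and> axis_square p s \<subseteq> axis_square (0, 0) 1"
  proof -
    have "(\<Union>(p, s)\<in>T. axis_square p s) \<subseteq> axis_square (0, 0) 1" using that by fast
    then have "(\<Union>(p, s)\<in>T. axis_square p s) = axis_square (0, 0) 1 \<longleftrightarrow>
       (\<forall>p\<in>axis_square (0, 0) 1. \<exists>q\<in>T. p \<in> axis_square (fst q) (sd q))"
      unfolding split_def by blast
    also have "\<dots> \<longleftrightarrow> (\<forall>x\<in>{0..1}. \<forall>y\<in>{0..1}. \<exists>q\<in>T. (x, y) \<in> axis_square (lx q, ly q) (sd q))"
      unfolding unit_square by simp
    finally show ?thesis by (simp add: mem_axis_square conj_assoc)
  qed
  show ?thesis
  \<comment> \<open>The equivalences for disjointness and covering presuppose positive sides and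
    containment; without these both sides of the claim are false.\<close>
  proof (cases "\<forall>q\<in>T. 0 < sd q \<and> 0 \<le> lx q \<and> 0 \<le> ly q \<and> lx q + sd q \<le> 1 \<and> ly q + sd q \<le> 1")
    case True
    then have "\<forall>q\<in>T. 0 < sd q" by simp
    then show ?thesis
      unfolding right_tiling_def tiling_def inside
      by (simp only: disj cover[OF inside[THEN iffD2, OF True]])
  next
    case False
    then show ?thesis unfolding right_tiling_def tiling_def inside by (simp only: simp_thms)
  qed
qed

lemma tiling_cover:
  assumes "tiling T" "x \<in> {0..1}" "y \<in> {0..1}"
  obtains q where "q \<in> T" "lx q \<le> x" "x \<le> lx q + sd q" "ly q \<le> y" "y \<le> ly q + sd q"
  using assms unfolding tiling_def by blast

lemma tiling_separated:
  assumes "tiling T" "q \<in> T" "r \<in> T" "q \<noteq> r"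
  shows "lx q + sd q \<le> lx r \<or> lx r + sd r \<le> lx q \<or> ly q + sd q \<le> ly r \<or> ly r + sd r \<le> ly q"
  using assms unfolding tiling_def by simp

lemma tiling_bounds:
  assumes "tiling T" "q \<in> T"
  shows "0 < sd q" "0 \<le> lx q" "0 \<le> ly q" "lx q + sd q \<le> 1" "ly q + sd q \<le> 1"
  using assms unfolding tiling_def by simp_all

lemma tiling_finite: "tiling T \<Longrightarrow> finite T"
  unfolding tiling_def by simp

section \<open>Symmetries of tilings\<close>

definition reflect_x where "reflect_x q = ((1 - lx q - sd q, ly q), sd q)"
text \<open>Conjugating \<open>reflect_x\<close> by this map swaps top and bottom, so the two maps
  bring every corner and every side into standard position.\<close>

definition reflect_diag where "reflect_diag q = ((ly q, lx q), sd q)"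

lemma reflect_x_simps [simp]: "lx (reflect_x q) = 1 - lx q - sd q"
  "ly (reflect_x q) = ly q" "sd (reflect_x q) = sd q"
  by (simp_all add: reflect_x_def)

lemma reflect_diag_simps [simp]: "lx (reflect_diag q) = ly q"
  "ly (reflect_diag q) = lx q" "sd (reflect_diag q) = sd q"
  by (simp_all add: reflect_diag_def)

lemma inj_reflect_x: "inj_on reflect_x T"
  by (rule inj_on_inverseI[of _ reflect_x]) (simp add: reflect_x_def)

lemma inj_reflect_diag: "inj_on reflect_diag T"
  by (rule inj_on_inverseI[of _ reflect_diag]) (simp add: reflect_diag_def)

lemma tiling_reflect_x:
  assumes T: "tiling T"
  shows "tiling (reflect_x ` T)"
  unfolding tiling_def
proof (intro conjI)
  show "finite (reflect_x ` T)" using tiling_finite[OF T] by simp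
  show "\<forall>q\<in>reflect_x ` T. 0 < sd q \<and> 0 \<le> lx q \<and> 0 \<le> ly q \<and> lx q + sd q \<le> 1 \<and> ly q + sd q \<le> 1"
    by (auto simp: tiling_bounds[OF T] dest: tiling_bounds(2,4)[OF T])
  show "\<forall>q\<in>reflect_x ` T. \<forall>r\<in>reflect_x ` T. q \<noteq> r \<longrightarrow> lx q + sd q \<le> lx r \<or> lx r + sd r \<le> lx q \<or>
        ly q + sd q \<le> ly r \<or> ly r + sd r \<le> ly q"
  proof (intro ballI impI)
    fix q' r' assume "q' \<in> reflect_x ` T" "r' \<in> reflect_x ` T" and ne: "q' \<noteq> r'"
    then obtain q r where qr: "q' = reflect_x q" "r' = reflect_x r" "q \<in> T" "r \<in> T" by blast
    with ne have "q \<noteq> r" by blast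
    from tiling_separated[OF T qr(3,4) this]
    show "lx q' + sd q' \<le> lx r' \<or> lx r' + sd r' \<le> lx q' \<or> ly q' + sd q' \<le> ly r' \<or> ly r' + sd r' \<le> ly q'"
      by (auto simp: qr)
  qed
  show "\<forall>x\<in>{0..1}. \<forall>y\<in>{0..1}. \<exists>q\<in>reflect_x ` T. lx q \<le> x \<and> x \<le> lx q + sd q \<and> ly q \<le> y \<and> y \<le> ly q + sd q"
  proof (intro ballI)
    fix x y :: real assume "x \<in> {0..1}" "y \<in> {0..1}"
    then obtain q where "q \<in> T" "lx q \<le> 1 - x" "1 - x \<le> lx q + sd q" "ly q \<le> y" "y \<le> ly q + sd q"
      using tiling_cover[OF T, of "1 - x" y] by auto
    then show "\<exists>q\<in>reflect_x ` T. lx q \<le> x \<and> x \<le> lx q + sd q \<and> ly q \<le> y \<and> y \<le> ly q + sd q"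
      by (intro bexI[of _ "reflect_x q"]) auto
  qed
qed

lemma tiling_reflect_diag:
  assumes T: "tiling T"
  shows "tiling (reflect_diag ` T)"
  unfolding tiling_def
proof (intro conjI)
  show "finite (reflect_diag ` T)" using tiling_finite[OF T] by simp
  show "\<forall>q\<in>reflect_diag ` T. 0 < sd q \<and> 0 \<le> lx q \<and> 0 \<le> ly q \<and> lx q + sd q \<le> 1 \<and> ly q + sd q \<le> 1"
    by (auto simp: tiling_bounds[OF T] dest: tiling_bounds(2,4)[OF T])
  show "\<forall>q\<in>reflect_diag ` T. \<forall>r\<in>reflect_diag ` T. q \<noteq> r \<longrightarrow> lx q + sd q \<le> lx r \<or> lx r + sd r \<le> lx q \<or>
        ly q + sd q \<le> ly r \<or> ly r + sd r \<le> ly q"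
  proof (intro ballI impI)
    fix q' r' assume "q' \<in> reflect_diag ` T" "r' \<in> reflect_diag ` T" and ne: "q' \<noteq> r'"
    then obtain q r where qr: "q' = reflect_diag q" "r' = reflect_diag r" "q \<in> T" "r \<in> T" by blast
    with ne have "q \<noteq> r" by blast
    from tiling_separated[OF T qr(3,4) this]
    show "lx q' + sd q' \<le> lx r' \<or> lx r' + sd r' \<le> lx q' \<or> ly q' + sd q' \<le> ly r' \<or> ly r' + sd r' \<le> ly q'"
      by (auto simp: qr)
  qed
  show "\<forall>x\<in>{0..1}. \<forall>y\<in>{0..1}. \<exists>q\<in>reflect_diag ` T. lx q \<le> x \<and> x \<le> lx q + sd q \<and> ly q \<le> y \<and> y \<le> ly q + sd q"
  proof (intro ballI)
    fix x y :: real assume xy: "x \<in> {0..1}" "y \<in> {0..1}"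
    obtain q where "q \<in> T" "lx q \<le> y" "y \<le> lx q + sd q" "ly q \<le> x" "x \<le> ly q + sd q"
      by (rule tiling_cover[OF T xy(2,1)])
    then show "\<exists>q\<in>reflect_diag ` T. lx q \<le> x \<and> x \<le> lx q + sd q \<and> ly q \<le> y \<and> y \<le> ly q + sd q"
      by (intro bexI[of _ "reflect_diag q"]) auto
  qed
qed

section \<open>From closed squares to half-open squares\<close>

lemma tiling_disjoint:
  assumes "tiling T" "q \<in> T" "r \<in> T" "p \<in> half_open q" "p \<in> half_open r"
  shows "q = r"
proof (rule ccontr)
  assume "q \<noteq> r"
  then have "lx q + sd q \<le> lx r \<or> lx r + sd r \<le> lx q \<or> ly q + sd q \<le> ly r \<or> ly r + sd r \<le> ly q"
    using assms unfolding tiling_def by blast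
  then show False using assms by (auto simp: half_open_def)
qed

text \<open>Approach \<open>(x, y)\<close> along \<open>(x + e, y + e)\<close> with \<open>e\<close>
  tending to 0 from above. A closed square containing such points for arbitrarily small
  \<open>e\<close> contains \<open>(x, y)\<close> in its half-open version.\<close>

lemma tiling_tiles:
  assumes T: "tiling T"
  shows "tiles T ({0..<1} \<times> {0..<1})"
proof -
  have "\<exists>q\<in>T. (x, y) \<in> half_open q" if xy: "0 \<le> x" "x < 1" "0 \<le> y" "y < 1" for x y
  proof -
    let ?A = "\<lambda>e q. lx q \<le> x + e \<and> x + e \<le> lx q + sd q \<and> ly q \<le> y + e \<and> y + e \<le> ly q + sd q"
    have small: "\<forall>\<^sub>F e in at_right (0::real). e < d" if "0 < d" for d
      using that by (auto simp: eventually_at_right)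
    have pos: "\<forall>\<^sub>F e in at_right (0::real). 0 < e"
      by (simp add: eventually_at_right_less)
    have "\<forall>\<^sub>F e in at_right 0. e < 1 - x" "\<forall>\<^sub>F e in at_right 0. e < 1 - y"
      using xy by (auto intro: small)
    then have "\<forall>\<^sub>F e in at_right 0. \<exists>q\<in>T. ?A e q"
      using pos
    proof (eventually_elim)
      case (elim e)
      then have "x + e \<in> {0..1}" "y + e \<in> {0..1}" using xy by auto
      then show ?case using tiling_cover[OF T] by metis
    qed
    then have "\<exists>\<^sub>F e in at_right 0. \<exists>q\<in>T. ?A e q"
      by (simp add: eventually_frequently)
    \<comment> \<open>Pigeonhole: there are finitely many squares, so one of them is hit for
      arbitrarily small \<open>e\<close>.\<close>
    then have "\<exists>q\<in>T. \<exists>\<^sub>F e in at_right 0. ?A e q"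
      by (rule frequently_bex_finite[OF tiling_finite[OF T]])
    then obtain q where q: "q \<in> T" "\<exists>\<^sub>F e in at_right 0. ?A e q" by blast
    have close: "\<exists>e. 0 < e \<and> e < d \<and> ?A e q" if "0 < d" for d
    proof -
      have "\<exists>\<^sub>F e in at_right 0. ?A e q \<and> 0 < e \<and> e < d"
        using frequently_eventually_conj[OF q(2), of "\<lambda>e. 0 < e \<and> e < d"] pos small[OF that]
        by (auto simp: eventually_conj_iff elim: frequently_elim1)
      then show ?thesis using frequently_ex by blast
    qed
    have "lx q \<le> x" using close[of "lx q - x"] by (cases "lx q \<le> x") auto
    moreover have "ly q \<le> y" using close[of "ly q - y"] by (cases "ly q \<le> y") auto
    moreover have "x < lx q + sd q" "y < ly q + sd q" using close[of 1] by auto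
    ultimately show ?thesis using q by (auto simp: half_open_def intro!: bexI[of _ q])
  qed
  then have "{0..<1} \<times> {0..<1} \<subseteq> (\<Union>q\<in>T. half_open q)" by fastforce
  moreover have "half_open q \<subseteq> {0..<1} \<times> {0..<1}" if "q \<in> T" for q
    using T that by (force simp: half_open_def tiling_def)
  ultimately have "(\<Union>q\<in>T. half_open q) = {0..<1} \<times> {0..<1}" by blast
  then show ?thesis
    using tiling_finite[OF T] tiling_bounds(1)[OF T] tiling_disjoint[OF T] unfolding tiles_def by blast
qed

section \<open>The squares along the top side\<close>

lemma tops_partition:
  assumes T: "tiling T"
  shows "(\<Union>q\<in>{q \<in> T. touches_top q}. {lx q..<lx q + sd q}) = {0..<1}" (is "?U = _")
    and "disjoint_family_on (\<lambda>q. {lx q..<lx q + sd q}) {q \<in> T. touches_top q}"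
proof -
  have fin: "finite T" using T by (simp add: tiling_def)
  show "?U = {0..<1}"
  proof
    show "?U \<subseteq> {0..<1}" using T by (force simp: tiling_def)
    show "{0..<1} \<subseteq> ?U"
    proof
      fix x :: real assume x: "x \<in> {0..<1}"
      \<comment> \<open>The line at height \<open>Max ?Z\<close> lies below 1 and no half-open
        square that stays below the top meets it. Inserting 0 makes the set nonempty and the height
        nonnegative.\<close>
      let ?Z = "insert 0 ((\<lambda>q. ly q + sd q) ` {q \<in> T. \<not> touches_top q})"
      have Z: "finite ?Z" using fin by simp
      have "\<forall>z\<in>?Z. z < 1" using T by (force simp: tiling_def touches_top_def)
      then have "Max ?Z < 1" "0 \<le> Max ?Z" using Z by (auto simp: fin intro: Max_ge)
      then have "(x, Max ?Z) \<in> (\<Union>q\<in>T. half_open q)"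
        using tiling_tiles[OF T] x unfolding tiles_def by auto
      then obtain q where q: "q \<in> T" "(x, Max ?Z) \<in> half_open q" by blast
      have "touches_top q"
      proof (rule ccontr)
        assume "\<not> touches_top q"
        then have "ly q + sd q \<le> Max ?Z" using q Z by (intro Max_ge) auto
        then show False using q by (simp add: half_open_def)
      qed
      then show "x \<in> ?U" using q by (intro UN_I[of q]) (auto simp: half_open_def)
    qed
  qed
  have "q = r" if "q \<in> T" "r \<in> T" "touches_top q" "touches_top r"
    "x \<in> {lx q..<lx q + sd q}" "x \<in> {lx r..<lx r + sd r}"
    for q r x
  proof -
    \<comment> \<open>At the higher of the two bottoms both squares are present above
      \<open>x\<close>.\<close>
    have "(x, max (ly q) (ly r)) \<in> half_open q" "(x, max (ly q) (ly r)) \<in> half_open r"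
      using that T by (auto simp: half_open_def touches_top_def tiling_def)
    then show ?thesis using tiling_disjoint[OF T] that by blast
  qed
  then show "disjoint_family_on (\<lambda>q. {lx q..<lx q + sd q}) {q \<in> T. touches_top q}"
    unfolding disjoint_family_on_def by blast
qed

text \<open>Compare Lebesgue measures: the bases of the top squares partition an interval of length
  1.\<close>

lemma sum_tops:
  assumes T: "tiling T"
  shows "(\<Sum>q | q \<in> T \<and> touches_top q. sd q) = 1"
proof -
  let ?I = "\<lambda>q. {lx q..<lx q + sd q}" and ?T = "{q \<in> T. touches_top q}"
  have "measure lborel (\<Union>q\<in>?T. ?I q) = (\<Sum>q\<in>?T. measure lborel (?I q))"
    using T tops_partition(2)[OF T] by (intro measure_finite_Union) (auto simp: tiling_def)
  also have "\<dots> = (\<Sum>q\<in>?T. sd q)"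
    using T by (intro sum.cong) (auto simp: tiling_def less_imp_le)
  finally show ?thesis using tops_partition(1)[OF T] by simp
qed

section \<open>Tilings whose corner squares are all smaller than 1/2\<close>

definition small_corners where
  "small_corners T \<longleftrightarrow> (\<forall>q\<in>T. (lx q = 0 \<or> lx q + sd q = 1) \<and> (ly q = 0 \<or> ly q + sd q = 1) \<longrightarrow> sd q < 1 / 2)"

lemma small_corners_reflect_x: "small_corners T \<Longrightarrow> small_corners (reflect_x ` T)"
  unfolding small_corners_def by auto

lemma small_corners_reflect_diag: "small_corners T \<Longrightarrow> small_corners (reflect_diag ` T)"
  unfolding small_corners_def by auto

text \<open>A top square over abscissa 1/2 that reached a corner would have side at least 1/2. The
  squares at abscissa 0 and just to the right of this one make three.\<close>

lemma inner_top:
  assumes T: "tiling T" and sc: "small_corners T"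
  obtains q where "q \<in> T" "touches_top q" "lx q \<noteq> 0" "lx q + sd q \<noteq> 1"
    and "3 \<le> card {q \<in> T. touches_top q}"
proof -
  let ?T = "{q \<in> T. touches_top q}"
  have cov: thesis if "0 \<le> x" "x < 1" "\<And>q. q \<in> T \<Longrightarrow> touches_top q \<Longrightarrow> lx q \<le> x \<Longrightarrow> x < lx q + sd q \<Longrightarrow> thesis"
    for x thesis
  proof -
    have "x \<in> (\<Union>q\<in>?T. {lx q..<lx q + sd q})" using tops_partition(1)[OF T] that(1,2) by simp
    then obtain q where "q \<in> ?T" "x \<in> {lx q..<lx q + sd q}" by (rule UN_E)
    then show thesis using that(3)[of q] by simp
  qed
  have sm: "sd q < 1 / 2" if "q \<in> T" "touches_top q" "lx q = 0 \<or> lx q + sd q = 1" for q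
    using sc that by (simp add: small_corners_def touches_top_def)
  obtain c where c: "c \<in> T" "touches_top c" "lx c \<le> 1 / 2" "1 / 2 < lx c + sd c"
    by (rule cov[of "1 / 2"]) auto
  have inner: "lx c \<noteq> 0" "lx c + sd c \<noteq> 1"
    using sm[OF c(1,2)] c(3,4) by linarith+
  obtain a where a: "a \<in> T" "touches_top a" "lx a \<le> 0"
    by (rule cov[of 0]) auto
  have a0: "lx a = 0" using a tiling_bounds(2)[OF T a(1)] by simp
  obtain b where b: "b \<in> T" "touches_top b" "lx b \<le> lx c + sd c" "lx c + sd c < lx b + sd b"
    by (rule cov[of "lx c + sd c"]) (use inner tiling_bounds[OF T c(1)] in auto)
  have "sd a < 1 / 2" using sm a a0 by blast
  then have "a \<noteq> c" "b \<noteq> c" "a \<noteq> b" using inner a0 b c by auto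
  then have "card {a, b, c} = 3" by simp
  moreover have "card {a, b, c} \<le> card ?T"
    using a b c tiling_finite[OF T] by (intro card_mono) auto
  ultimately show thesis using that[OF c(1,2) inner] by simp
qed

subsection \<open>The maximum\<close>

lemma corner_square:
  assumes T: "tiling T"
  obtains s where "((0, 0), s) \<in> T" "0 < s"
proof -
  have "(0, 0) \<in> (\<Union>q\<in>T. half_open q)" using tiling_tiles[OF T] unfolding tiles_def by simp
  then obtain q where q: "q \<in> T" "(0, 0) \<in> half_open q" by blast
  then have "q = ((0, 0), sd q)" using tiling_bounds[OF T q(1)]
    by (intro prod_eqI) (auto simp: half_open_def)
  then show thesis using that[of "sd q"] q tiling_bounds(1)[OF T q(1)] by simp
qed

text \<open>Once the corner square is placed, the skyline is one step of height \<open>s\<close>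
  followed by a floor of width \<open>1 - s\<close>. As \<open>s < 1\<close>, that square misses the
  top, so the top squares still sum to 1 and the others to the rest.\<close>

lemma fill_after_corner:
  assumes T: "tiling T" and a: "((0, 0), s) \<in> T" and s: "0 < s" "s < 1"
    and n: "real (card {q \<in> T - {((0, 0), s)}. P (ly q)}) \<le> n"
    and t: "\<And>q. q \<in> T \<Longrightarrow> q \<noteq> ((0, 0), s) \<Longrightarrow> sd q \<le> t"
  shows "fill0 P t n (t * real (card {q \<in> T. touches_top q}))
    (t * (real (card T) - 1 - real (card {q \<in> T. touches_top q})))
    1 (sum sd T - s - 1) [(s, s)] (1 - s) 0 []"
proof -
  let ?a = "((0, 0), s) :: (real \<times> real) \<times> real"
  let ?N = "T - {?a}"
  have fin: "finite T" by (rule tiling_finite[OF T])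
  have "\<not> touches_top ?a" using s by (simp add: touches_top_def)
  then have top: "{q \<in> ?N. touches_top q} = {q \<in> T. touches_top q}" by auto
  have un: "?N = {q \<in> ?N. touches_top q} \<union> {q \<in> ?N. \<not> touches_top q}" by auto
  have dj: "{q \<in> ?N. touches_top q} \<inter> {q \<in> ?N. \<not> touches_top q} = {}" by auto
  have f2: "finite {q \<in> ?N. touches_top q}" "finite {q \<in> ?N. \<not> touches_top q}" using fin by auto
  have "card ?N = card {q \<in> ?N. touches_top q} + card {q \<in> ?N. \<not> touches_top q}"
    using arg_cong[OF un, of card] card_Un_disjoint[OF f2 dj] by (rule trans)
  moreover have "card T = Suc (card ?N)" using fin a by (rule card.remove)
  ultimately have card: "real (card {q \<in> ?N. \<not> touches_top q}) =
      real (card T) - 1 - real (card {q \<in> T. touches_top q})"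
    unfolding top by simp
  have "sum sd ?N = sum sd {q \<in> ?N. touches_top q} + sum sd {q \<in> ?N. \<not> touches_top q}"
    using arg_cong[OF un, of "sum sd"] sum.union_disjoint[OF f2 dj, of sd] by (rule trans)
  moreover have "sum sd T = s + sum sd ?N" using sum.remove[OF fin a, of sd] by simp
  ultimately have sum: "sum sd {q \<in> ?N. \<not> touches_top q} = sum sd T - s - 1"
    unfolding top using sum_tops[OF T] by simp
  have "tiles ?N ({0..<1} \<times> {0..<1} - half_open ?a)"
    using tiling_tiles[OF T] a by (rule tiles_remove)
  also have "{0..<1} \<times> {0..<1} - half_open ?a = region s [(s, s)] (1 - s) 0 []"
    using s by (auto simp: half_open_def)
  finally have "filling P t n (t * real (card {q \<in> T. touches_top q}))
    (t * (real (card T) - 1 - real (card {q \<in> T. touches_top q})))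
    1 (sum sd T - s - 1) ?N s [(s, s)] (1 - s) 0 []"
    using n t s sum_tops[OF T] unfolding filling_def counts_def card sum top by auto
  then show ?thesis unfolding fill0_def by blast
qed

section \<open>Tilings with a corner square of side at least 1/2\<close>

lemma bound_half_corner_aux:
  assumes T: "tiling T" "card T = 8" and a: "((0, 0), s) \<in> T" "1 / 2 \<le> s"
    and low: "card {q \<in> T - {((0, 0), s)}. ly q < s} \<le> 3"
  shows "sum sd T \<le> 13 / 5"
proof (rule ccontr)
  assume S: "\<not> ?thesis"
  \<comment> \<open>Every other square lies to the right of the corner square or above it.\<close>
  have small: "sd q \<le> 1 - s" if "q \<in> T" "q \<noteq> ((0, 0), s)" for q
    using tiling_separated[OF T(1) that(1) a(1) that(2)] tiling_bounds[OF T(1) that(1)] by auto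
  have "\<not> T \<subseteq> {((0, 0), s)}"
  proof
    assume "T \<subseteq> {((0, 0), s)}"
    then have "card T \<le> 1" using card_mono[of "{((0, 0), s)}" T] by simp
    then show False using T by simp
  qed
  then obtain q where "q \<in> T" "q \<noteq> ((0, 0), s)" by blast
  then have s: "s < 1" using small tiling_bounds(1)[OF T(1)] by fastforce
  define t where "t = 1 - s"
  define k where "k = card {q \<in> T. touches_top q}"
  define u where "u = sum sd T - s - 1"
  have s_t: "s = 1 - t" and t: "0 < t" "t \<le> 1 / 2" using s a by (auto simp: t_def)
  have "fill0 (\<lambda>y. y < s) t 3 (t * real k) (t * (real (card T) - 1 - real k)) 1 (sum sd T - s - 1)
    [(s, s)] (1 - s) 0 []"
    unfolding k_def
    by (rule fill_after_corner[OF T(1) a(1)]) (use a s low small in \<open>auto simp: t_def\<close>)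
  then have F: "fill0 (\<lambda>y. y < 1 - t) t 3 (t * real k) (t * (7 - real k)) 1 u [(1 - t, 1 - t)] t 0 []"
    by (simp add: T(2) s_t u_def)
  have u: "3 / 5 + t < u" using S s_t by (simp add: u_def)
  obtain Q x where "filling (\<lambda>y. y < 1 - t) t 3 (t * real k) (t * (7 - real k)) 1 u Q x
      [(1 - t, 1 - t)] t 0 []"
    using F by (auto simp: fill0_def)
  then have "counts (\<lambda>y. y < 1 - t) t 3 (t * real k) (t * (7 - real k)) 1 u Q"
    "finite Q" "\<forall>q\<in>Q. 0 < sd q"
    unfolding filling_def tiles_def by simp_all
  note b = counts_bound(2,4)[OF this]
  \<comment> \<open>Since \<open>1 <= t * k <= k / 2\<close>, at least two squares touch the
    top.\<close>
  moreover have "t * real k \<le> 1 / 2 * real k" using t by (intro mult_right_mono) auto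
  ultimately have k2: "2 \<le> k" and k7: "3 / 5 + t < t * (7 - real k)" using u by auto
  \<comment> \<open>With five top squares \<open>u\<close> would be at most \<open>2 * t\<close>,
    forcing \<open>t > 3/5\<close>.\<close>
  have "k < 5"
  proof (rule ccontr)
    assume "\<not> k < 5"
    then have "t * (7 - real k) \<le> t * 2" using t by (intro mult_left_mono) auto
    then show False using k7 t by linarith
  qed
  then consider "k = 4" | "k = 3" | "k = 2" using k2 by linarith
  then show False
  proof cases
    case 1
    then have "u \<le> t * 3" "t * (7 - real k) = t * 3" using b(2) by simp_all
    then show False using F u t b(1) 1 by (intro no_filling_4_3[of t u]) simp_all
  next
    case 2
    then have "u \<le> t * 4" "t * (7 - real k) = t * 4" using b(2) by simp_all
    then show False using F u t b(1) 2 by (intro no_filling_3_4[of t u]) simp_all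
  next
    case 3
    then have "u \<le> t * 5" "t * (7 - real k) = t * 5" using b(2) by simp_all
    then show False using F u t b(1) 3 by (intro no_filling_2_5[of t u]) simp_all
  qed
qed

lemma bound_half_corner:
  assumes T: "tiling T" "card T = 8" and a: "((0, 0), s) \<in> T" "1 / 2 \<le> s"
  shows "sum sd T \<le> 13 / 5"
proof -
  let ?a = "((0, 0), s) :: (real \<times> real) \<times> real"
  let ?R = "{q \<in> T - {?a}. ly q < s}" and ?U = "{q \<in> T - {?a}. lx q < s}"
  have fin: "finite T" by (rule tiling_finite[OF T(1)])
  \<comment> \<open>A square in both sets would overlap the corner square. So the seven other
    squares cannot include four of each kind, and reflection in the diagonal exchanges the
    kinds.\<close>
  have "?R \<inter> ?U = {}"
    using tiling_separated[OF T(1) _ a(1)] tiling_bounds[OF T(1)] by fastforce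
  then have "card ?R + card ?U = card (?R \<union> ?U)" using fin by (intro card_Un_disjoint[symmetric]) auto
  also have "\<dots> \<le> card (T - {?a})" using fin by (intro card_mono) auto
  also have "\<dots> = 7" using T a fin by simp
  finally consider "card ?R \<le> 3" | "card ?U \<le> 3" by linarith
  then show ?thesis
  proof cases
    case 1
    with assms show ?thesis by (intro bound_half_corner_aux)
  next
    case 2
    have "reflect_diag ?a = ?a" by (simp add: reflect_diag_def)
    then have "?a \<in> reflect_diag ` T" using a by (metis imageI)
    moreover have "{q \<in> reflect_diag ` T - {?a}. ly q < s} = reflect_diag ` ?U"
      by (auto simp: reflect_diag_def)
    then have "card {q \<in> reflect_diag ` T - {?a}. ly q < s} \<le> 3"
      using 2 by (simp add: card_image inj_reflect_diag)
    ultimately have "sum sd (reflect_diag ` T) \<le> 13 / 5"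
      using T a
      by (intro bound_half_corner_aux[of _ s]) (simp_all add: tiling_reflect_diag card_image inj_reflect_diag)
    then show ?thesis by (simp add: sum.reindex inj_reflect_diag)
  qed
qed

lemma reflect_x_invariants:
  "card (reflect_x ` T) = card T" "sum sd (reflect_x ` T) = sum sd T"
  by (simp_all add: card_image sum.reindex inj_reflect_x)

lemma reflect_diag_invariants:
  "card (reflect_diag ` T) = card T" "sum sd (reflect_diag ` T) = sum sd T"
  by (simp_all add: card_image sum.reindex inj_reflect_diag)

lemma bound_bottom_corner:
  assumes T: "tiling T" "card T = 8"
    and q: "q \<in> T" "1 / 2 \<le> sd q" "lx q = 0 \<or> lx q + sd q = 1" "ly q = 0"
  shows "sum sd T \<le> 13 / 5"
proof (cases "lx q = 0")
  case True
  then have "q = ((0, 0), sd q)" using q by (intro prod_eqI) simp_all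
  then have "((0, 0), sd q) \<in> T" using q by metis
  then show ?thesis using T q by (intro bound_half_corner)
next
  case False
  then have "reflect_x q = ((0, 0), sd q)" using q by (simp add: reflect_x_def)
  then have "((0, 0), sd q) \<in> reflect_x ` T" using q by (metis imageI)
  then have "sum sd (reflect_x ` T) \<le> 13 / 5"
    using T q by (intro bound_half_corner) (simp_all add: tiling_reflect_x reflect_x_invariants)
  then show ?thesis by (simp add: reflect_x_invariants)
qed

lemma bound_corner:
  assumes T: "tiling T" "card T = 8"
    and q: "q \<in> T" "1 / 2 \<le> sd q" "lx q = 0 \<or> lx q + sd q = 1" "ly q = 0 \<or> ly q + sd q = 1"
  shows "sum sd T \<le> 13 / 5"
proof (cases "ly q = 0")
  case True
  with assms show ?thesis by (intro bound_bottom_corner)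
next
  case False
  \<comment> \<open>This is the reflection exchanging top and bottom.\<close>
  let ?f = "\<lambda>q. reflect_diag (reflect_x (reflect_diag q))"
  let ?T = "reflect_diag ` reflect_x ` reflect_diag ` T"
  have "?f q \<in> ?T" using q by blast
  then have "sum sd ?T \<le> 13 / 5"
    using T q False
    by (intro bound_bottom_corner[of _ "?f q"])
      (auto simp: tiling_reflect_x tiling_reflect_diag reflect_x_invariants reflect_diag_invariants)
  then show ?thesis by (simp add: reflect_x_invariants reflect_diag_invariants)
qed

lemma bound_small_corners:
  assumes T: "tiling T" "card T = 8" and sc: "small_corners T"
  shows "sum sd T \<le> 13 / 5"
proof (rule ccontr)
  assume S: "\<not> ?thesis"
  have fin: "finite T" by (rule tiling_finite[OF T(1)])
  let ?top = "{q \<in> T. touches_top q}" and ?bot = "{q \<in> T. ly q = 0}"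
  have t3: "3 \<le> card ?top" using inner_top[OF T(1) sc] by blast
  have b3: "3 \<le> card ?bot"
  proof -
    let ?f = "\<lambda>q. reflect_diag (reflect_x (reflect_diag q))"
    let ?T = "reflect_diag ` reflect_x ` reflect_diag ` T"
    have "3 \<le> card {q \<in> ?T. touches_top q}"
      using inner_top[of ?T] T(1) sc
      by (metis small_corners_reflect_diag small_corners_reflect_x tiling_reflect_diag tiling_reflect_x)
    also have "{q \<in> ?T. touches_top q} = ?f ` ?bot"
      by (auto simp: touches_top_def)
    also have "card \<dots> \<le> card ?bot" using fin by (intro card_image_le) auto
    finally show ?thesis .
  qed
  obtain r where r: "r \<in> T" "lx r + sd r = 1" "ly r \<noteq> 0" "ly r + sd r \<noteq> 1"
  proof (rule inner_top[OF tiling_reflect_diag[OF T(1)] small_corners_reflect_diag[OF sc]])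
    fix q assume "q \<in> reflect_diag ` T" "touches_top q" "lx q \<noteq> 0" "lx q + sd q \<noteq> 1"
    then show thesis using that by (auto simp: touches_top_def)
  qed
  obtain l where l: "l \<in> T" "lx l = 0" "ly l \<noteq> 0" "ly l + sd l \<noteq> 1"
  proof (rule inner_top[OF tiling_reflect_diag[OF tiling_reflect_x[OF T(1)]]
        small_corners_reflect_diag[OF small_corners_reflect_x[OF sc]]])
    fix q assume "q \<in> reflect_diag ` reflect_x ` T" "touches_top q" "lx q \<noteq> 0" "lx q + sd q \<noteq> 1"
    then show thesis using that by (auto simp: touches_top_def)
  qed
  \<comment> \<open>A square touching both vertical sides would have side 1 and hence start at
    height 0.\<close>
  have "l \<noteq> r" using l r tiling_bounds[OF T(1) r(1)] by auto
  have "?top \<inter> ?bot = {}"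
  proof (rule ccontr)
    assume "?top \<inter> ?bot \<noteq> {}"
    then obtain q where q: "q \<in> T" "touches_top q" "ly q = 0" by blast
    then have "sd q = 1" by (simp add: touches_top_def)
    then show False using sc q tiling_bounds[OF T(1) q(1)] by (auto simp: small_corners_def)
  qed
  then have "card (?top \<union> ?bot) = card ?top + card ?bot"
    using fin by (intro card_Un_disjoint) auto
  moreover have "card ({l, r} \<union> (?top \<union> ?bot)) = card {l, r} + card (?top \<union> ?bot)"
    using fin l r by (intro card_Un_disjoint) (auto simp: touches_top_def)
  moreover have "card ({l, r} \<union> (?top \<union> ?bot)) \<le> card T"
    using fin l r by (intro card_mono) auto
  \<comment> \<open>The count is tight: at least 3 + 3 squares at top and bottom, plus
    \<open>l\<close> and \<open>r\<close>, out of 8.\<close>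
  ultimately have c: "card ?top = 3" "card ?bot = 3" using T t3 b3 \<open>l \<noteq> r\<close> by auto
  obtain s where a: "((0, 0), s) \<in> T" "0 < s" by (rule corner_square[OF T(1)])
  then have s: "s < 1 / 2" using sc by (force simp: small_corners_def)
  have "{q \<in> T - {((0, 0), s)}. ly q \<le> 0} = ?bot - {((0, 0), s)}"
    using tiling_bounds(3)[OF T(1)] by (auto intro: antisym)
  then have low: "card {q \<in> T - {((0, 0), s)}. ly q \<le> 0} = 2" using a c fin by simp
  \<comment> \<open>The trivial bound 1 on the sides turns \<open>K\<close> and \<open>M\<close>
    into plain counts. The corner square is one of the three at the bottom, which leaves two; a
    total above 13/5 means that \<open>u\<close> exceeds \<open>8/5 - s\<close>.\<close>
  have "fill0 (\<lambda>y. y \<le> 0) 1 2 (1 * real (card ?top)) (1 * (real (card T) - 1 - real (card ?top)))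
    1 (sum sd T - s - 1) [(s, s)] (1 - s) 0 []"
  proof (rule fill_after_corner[OF T(1) a])
    show "sd q \<le> 1" if "q \<in> T" for q using tiling_bounds[OF T(1) that] by simp
  qed (use s low in auto)
  then have "fill0 (\<lambda>y. y \<le> 0) 1 2 3 4 1 (sum sd T - s - 1) [(s, s)] (1 - s) 0 []"
    by (simp add: c T)
  from no_filling_small_corner[OF this a(2) s] S show False by simp
qed

lemma sum_sides_le:
  assumes T: "tiling T" "card T = 8"
  shows "sum sd T \<le> 13 / 5"
proof (cases "small_corners T")
  case True
  with T show ?thesis by (rule bound_small_corners)
next
  case False
  then obtain q where "q \<in> T" "1 / 2 \<le> sd q" "lx q = 0 \<or> lx q + sd q = 1" "ly q = 0 \<or> ly q + sd q = 1"
    by (auto simp: small_corners_def not_less)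
  with T show ?thesis by (rule bound_corner)
qed

text \<open>A square of side 3/5 leaves an L-shaped strip of width 2/5. Squares of side 2/5 occupy
  the three remaining corners, and each of the two gaps between them takes two squares of side
  1/5.\<close>

definition optimal_tiling :: "((real \<times> real) \<times> real) set" where
  "optimal_tiling = {((0, 0), 3/5), ((3/5, 0), 2/5), ((0, 3/5), 2/5), ((3/5, 3/5), 2/5),
     ((2/5, 3/5), 1/5), ((2/5, 4/5), 1/5), ((3/5, 2/5), 1/5), ((4/5, 2/5), 1/5)}"

lemma optimal_tiling: "tiling optimal_tiling" "card optimal_tiling = 8" "sum sd optimal_tiling = 13 / 5"
proof -
  show "tiling optimal_tiling"
    unfolding tiling_def
  proof (intro conjI ballI)
    fix x y :: real assume "x \<in> {0..1}" "y \<in> {0..1}"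
    then show "\<exists>q\<in>optimal_tiling. lx q \<le> x \<and> x \<le> lx q + sd q \<and> ly q \<le> y \<and> y \<le> ly q + sd q"
      unfolding optimal_tiling_def by simp argo
  qed (auto simp: optimal_tiling_def)
qed (simp_all add: optimal_tiling_def)

theorem theorem9: "psi3 8 = 13 / 5"
  unfolding psi3_def
proof (rule Greatest_equality)
  have "(\<Sum>(p, s)\<in>optimal_tiling. s) = 13 / 5" using optimal_tiling(3) by (simp add: split_def)
  then show "\<exists>T. right_tiling T \<and> card T = 8 \<and> 13 / 5 = (\<Sum>(p, s)\<in>T. s)"
    using optimal_tiling(1,2) right_tiling_iff by metis
next
  fix m assume "\<exists>T. right_tiling T \<and> card T = 8 \<and> m = (\<Sum>(p, s)\<in>T. s)"
  then obtain T where "tiling T" "card T = 8" "m = sum sd T"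
    by (auto simp: right_tiling_iff split_def)
  then show "m \<le> 13 / 5" using sum_sides_le by simp
qed

end
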